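(* In the linear-model setting of the context, suppose there exist $B_\ell$ and $M_\ell$ such that $\ell''$ is $M_\ell$-Lipschitz continuous and $0\le\ell''(a^\top x)\le B_\ell$ almost surely for all $x\in\mathcal{B}(0,D)$. Let $\delta\in(0,1)$. Then, with probability at least $1-\delta$, $$\sup_{x\in\mathcal{B}(0,D)}\|H_f(x)-H_F(x)\|_{\mathrm{op}}\le\mu$$ for $$\mu=\sqrt{4\pi}\,\frac{R^2}{\sqrt n}\left(B_\ell\left[2+\sqrt{\frac{1}{2\pi}\log(\delta^{-1})}\right]+RM_\ell D\right).$$
   Context: The data set consists of $N$ samples $z_i=(a_i,b_i)$ with $a_i\in\mathbb{R}^d$ and $\|a_i\|\le R$ for all $i$ (Euclidean norm). Losses have the form $\ell(x,z_i)=\ell_i(a_i^\top x)+\frac\lambda2\|x\|^2$ with $\lambda>0$, where each $\ell_i:\mathbb{R}\to\mathbb{R}$ is twice differentiable and all second derivatives coincide, $\ell_i''=\ell_j''=:\ell''$. The overall loss $F$ is the average of $\ell(x,z_i)$ over the whole data set, and the local loss $f$ is the average of $\ell(x,z)$ over $n$ samples drawn independently and uniformly at random with replacement from it. With $a$ uniform over the feature vectors of the data set and $\tilde a_1,\dots,\tilde a_n$ the feature vectors of the drawn samples (i.i.d. copies of $a$), $$H_F(x)=\nabla^2F(x)=\mathbb{E}[\ell''(a^\top x)aa^\top]+\lambda I_d,\qquad H_f(x)=\nabla^2f(x)=\frac1n\sum_{i=1}^n\ell''(\tilde a_i^\top x)\tilde a_i\tilde a_i^\top+\lambda I_d.$$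 $\mathcal{B}(0,D)$ is the Euclidean ball of radius $D>0$ centered at $0$ in $\mathbb{R}^d$, and $\|\cdot\|_{\mathrm{op}}$ is the operator (spectral) norm. *)

theory Defs
  imports "HOL-Probability.Probability"
begin

definition gradient :: "('a::real_inner \<Rightarrow> real) \<Rightarrow> 'a \<Rightarrow> 'a" where
  "gradient f x = (THE g. GDERIV f x :> g)"

definition hessian :: "(real ^ 'd \<Rightarrow> real) \<Rightarrow> real ^ 'd \<Rightarrow> real ^ 'd ^ 'd" where
  "hessian f x = jacobian (gradient f) (at x)"

definition op_norm :: "real ^ 'd ^ 'd \<Rightarrow> real" where
  "op_norm A = onorm ((*v) A)"

definition outer :: "real ^ 'd \<Rightarrow> real ^ 'd ^ 'd" where
  "outer v = (\<chi> i j. v $ i * v $ j)"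

text \<open>
  A data set of \<open>N\<close> samples is indexed by \<open>{..<N}\<close>. Sample \<open>i\<close> has feature vector \<open>a i\<close>; its label
  enters only through the scalar loss \<open>l i\<close>.
\<close>

definition sample_loss ::
    "real \<Rightarrow> (nat \<Rightarrow> real ^ 'd) \<Rightarrow> (nat \<Rightarrow> real \<Rightarrow> real) \<Rightarrow> nat \<Rightarrow> real ^ 'd \<Rightarrow> real" where
  "sample_loss lam a l i x = l i (a i \<bullet> x) + lam / 2 * (norm x)\<^sup>2"

text \<open>The average of the losses of the samples \<open>s 0, \<dots>, s (m - 1)\<close>; indices may repeat.\<close>

definition avg_loss ::
    "real \<Rightarrow> (nat \<Rightarrow> real ^ 'd) \<Rightarrow> (nat \<Rightarrow> real \<Rightarrow> real) \<Rightarrow> nat \<Rightarrow> (nat \<Rightarrow> nat) \<Rightarrow> real ^ 'd \<Rightarrow> real" where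
  "avg_loss lam a l m s x = (\<Sum>j<m. sample_loss lam a l (s j) x) / real m"

definition overall_loss ::
    "real \<Rightarrow> (nat \<Rightarrow> real ^ 'd) \<Rightarrow> (nat \<Rightarrow> real \<Rightarrow> real) \<Rightarrow> nat \<Rightarrow> real ^ 'd \<Rightarrow> real" where
  "overall_loss lam a l N = avg_loss lam a l N (\<lambda>i. i)"

text \<open>In \<open>local_loss\<close>, \<open>s j\<close> is the data set index of the \<open>j\<close>-th drawn sample.\<close>

definition local_loss ::
    "real \<Rightarrow> (nat \<Rightarrow> real ^ 'd) \<Rightarrow> (nat \<Rightarrow> real \<Rightarrow> real) \<Rightarrow> nat \<Rightarrow> (nat \<Rightarrow> nat) \<Rightarrow> real ^ 'd \<Rightarrow> real" where
  "local_loss lam a l n s = avg_loss lam a l n s"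

definition feature_pmf :: "(nat \<Rightarrow> real ^ 'd) \<Rightarrow> nat \<Rightarrow> (real ^ 'd) pmf" where
  "feature_pmf a N = map_pmf a (pmf_of_set {..<N})"

lemma gradient_eqI:
  assumes "GDERIV f x :> g"
  shows "gradient f x = g"
  unfolding gradient_def
proof (rule the_equality)
  fix g' assume "GDERIV f x :> g'"
  then have "(\<lambda>h. h \<bullet> g') = (\<lambda>h. h \<bullet> g)"
    using assms unfolding gderiv_def by (rule has_derivative_unique)
  then show "g' = g"
    using vector_eq_ldot[of g' g] by (simp add: fun_eq_iff)
qed (fact assms)

lemma hessian_avg_loss:
  fixes a :: "nat \<Rightarrow> real ^ 'd"
  assumes m: "m > 0"
    and d1: "\<And>j t. j < m \<Longrightarrow> l (s j) differentiable (at t)"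
    and d2: "\<And>j t. j < m \<Longrightarrow> (deriv (l (s j)) has_real_derivative l2 t) (at t)"
  shows "hessian (avg_loss lam a l m s) x =
    (1 / real m) *\<^sub>R (\<Sum>j<m. l2 (a (s j) \<bullet> x) *\<^sub>R outer (a (s j))) + lam *\<^sub>R mat 1"
proof -
  have D1: "(l (s j) has_real_derivative deriv (l (s j)) t) (at t)" if "j < m" for j t
    using d1[OF that] DERIV_deriv_iff_real_differentiable by blast
  define G where "G = (\<lambda>y. (1 / real m) *\<^sub>R (\<Sum>j<m. deriv (l (s j)) (a (s j) \<bullet> y) *\<^sub>R a (s j)) + lam *\<^sub>R y)"
  have G: "gradient (avg_loss lam a l m s) = G"
  proof (rule ext, rule gradient_eqI)
    fix y
    have L: "((\<lambda>y. l (s j) (a (s j) \<bullet> y)) has_derivative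
            (\<lambda>h. (a (s j) \<bullet> h) * deriv (l (s j)) (a (s j) \<bullet> y))) (at y)" if "j < m" for j
      by (rule has_derivative_eq_rhs, rule has_derivative_compose[OF _ D1[OF that, unfolded has_field_derivative_def]])
         (auto intro!: derivative_eq_intros simp: mult.commute)
    have "((\<lambda>y. (\<Sum>j<m. l (s j) (a (s j) \<bullet> y) + lam / 2 * (y \<bullet> y)) / real m) has_derivative
        (\<lambda>h. (\<Sum>j<m. (a (s j) \<bullet> h) * deriv (l (s j)) (a (s j) \<bullet> y) + lam / 2 * (y \<bullet> h + h \<bullet> y)) / real m)) (at y)"
      using m by (auto intro!: derivative_eq_intros L)
    then show "GDERIV (avg_loss lam a l m s) y :> G y"
      unfolding gderiv_def avg_loss_def sample_loss_def G_def power2_norm_eq_inner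
      by (rule has_derivative_eq_rhs)
         (use m in \<open>auto simp: inner_add_right inner_sum_right sum.distrib field_simps inner_commute fun_eq_iff\<close>)
  qed
  define A where "A = (1 / real m) *\<^sub>R (\<Sum>j<m. l2 (a (s j) \<bullet> x) *\<^sub>R outer (a (s j))) + lam *\<^sub>R mat 1"
  have O: "outer v *v h = (v \<bullet> h) *\<^sub>R v" for v h :: "real ^ 'd"
    by (simp add: outer_def matrix_vector_mult_def vec_eq_iff inner_vec_def sum_distrib_left sum_distrib_right mult_ac)
  have A: "A *v h = (1 / real m) *\<^sub>R (\<Sum>j<m. (l2 (a (s j) \<bullet> x) * (a (s j) \<bullet> h)) *\<^sub>R a (s j)) + lam *\<^sub>R h" for h
  proof -
    have S: "(\<Sum>j<k. B j) *v h = (\<Sum>j<k. B j *v h)" for B :: "nat \<Rightarrow> real ^ 'd ^ 'd" and k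
      by (induction k) (simp_all add: matrix_vector_mult_add_rdistrib)
    show ?thesis
      by (simp add: A_def matrix_vector_mult_add_rdistrib scaleR_matrix_vector_assoc[symmetric] S O)
  qed
  have L: "((\<lambda>y. deriv (l (s j)) (a (s j) \<bullet> y)) has_derivative
          (\<lambda>h. l2 (a (s j) \<bullet> x) * (a (s j) \<bullet> h))) (at x)" if "j < m" for j
    by (rule has_derivative_eq_rhs, rule has_derivative_compose[OF _ d2[OF that, unfolded has_field_derivative_def]])
       (auto intro!: derivative_eq_intros simp: mult.commute)
  have "(G has_derivative (*v) A) (at x)"
    unfolding G_def by (auto intro!: derivative_eq_intros L simp: A fun_eq_iff)
  then have "frechet_derivative G (at x) = (*v) A"
    by (rule frechet_derivative_at[symmetric])
  then show ?thesis
    unfolding hessian_def G jacobian_def A_def[symmetric] by simp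
qed

corollary hessian_local_loss:
  assumes "n > 0" "\<And>j. j < n \<Longrightarrow> s j < N"
    and "\<And>i t. i < N \<Longrightarrow> l i differentiable (at t)"
    and "\<And>i t. i < N \<Longrightarrow> (deriv (l i) has_real_derivative l2 t) (at t)"
  shows "hessian (local_loss lam a l n s) x =
    (1 / real n) *\<^sub>R (\<Sum>j<n. l2 (a (s j) \<bullet> x) *\<^sub>R outer (a (s j))) + lam *\<^sub>R mat 1"
  unfolding local_loss_def by (rule hessian_avg_loss) (use assms in auto)

corollary hessian_overall_loss:
  assumes N: "N > 0"
    and "\<And>i t. i < N \<Longrightarrow> l i differentiable (at t)"
    and "\<And>i t. i < N \<Longrightarrow> (deriv (l i) has_real_derivative l2 t) (at t)"
  shows "hessian (overall_loss lam a l N) x =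
    measure_pmf.expectation (feature_pmf a N) (\<lambda>v. l2 (v \<bullet> x) *\<^sub>R outer v) + lam *\<^sub>R mat 1"
proof -
  have "measure_pmf.expectation (feature_pmf a N) (\<lambda>v. l2 (v \<bullet> x) *\<^sub>R outer v) =
      measure_pmf.expectation (pmf_of_set {..<N}) (\<lambda>i. l2 (a i \<bullet> x) *\<^sub>R outer (a i))"
    unfolding feature_pmf_def by simp
  also have "\<dots> = (\<Sum>i<N. pmf (pmf_of_set {..<N}) i *\<^sub>R l2 (a i \<bullet> x) *\<^sub>R outer (a i))"
    by (rule integral_measure_pmf) (use N in \<open>auto simp: set_pmf_of_set lessThan_empty_iff\<close>)
  also have "\<dots> = (1 / real N) *\<^sub>R (\<Sum>i<N. l2 (a i \<bullet> x) *\<^sub>R outer (a i))"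
    unfolding scaleR_sum_right using N
    by (intro sum.cong) (auto simp: lessThan_empty_iff)
  finally show ?thesis
    unfolding overall_loss_def
    by (simp only:) (rule hessian_avg_loss, use assms in auto)
qed

end

theory Submission
  imports Defs
begin

text \<open>
  The operator norm is bounded by the Frobenius norm, which is the supremum of the inner products with
  the matrices \<open>V\<close> in the Frobenius unit ball. So it suffices to bound the supremum over \<open>(x, V)\<close> of the
  centred sums of \<open>g i (x, V) = l2 (a i \<bullet> x) * (outer (a i) \<bullet> V)\<close>; since the ball is symmetric, no
  absolute value remains. McDiarmid's inequality, with differences bounded by \<open>2 * B * R\<^sup>2\<close>, gives
  exactly the \<open>\<delta>\<close>-dependent part of \<open>\<mu>\<close>. The mean is bounded by Rademacher symmetrization followed by a
  contraction that replaces the product \<open>g\<close> by the two linear processes \<open>a i \<bullet> x\<close> and \<open>outer (a i) \<bullet> V\<close>,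
  whose signed sums are of order \<open>sqrt n\<close> by the parallelogram law.
\<close>

subsection \<open>Averages over uniform draws\<close>

definition avg :: "nat \<Rightarrow> (nat \<Rightarrow> real) \<Rightarrow> real" where
  "avg N f = (\<Sum>i<N. f i) / real N"

text \<open>Extensional functions make this a finite set with \<open>N ^ n\<close> elements, so
  expectations over draws with replacement become finite sums, free of measurability
  questions.\<close>

definition draws :: "nat \<Rightarrow> nat \<Rightarrow> (nat \<Rightarrow> nat) set" where
  "draws N n = {..<n} \<rightarrow>\<^sub>E {..<N}"

definition draw_mean :: "nat \<Rightarrow> nat \<Rightarrow> ((nat \<Rightarrow> nat) \<Rightarrow> real) \<Rightarrow> real" where
  "draw_mean N n f = (\<Sum>s\<in>draws N n. f s) / real N ^ n"

lemma avg_mono: "(\<And>i. i < N \<Longrightarrow> f i \<le> g i) \<Longrightarrow> avg N f \<le> avg N g"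
  unfolding avg_def by (intro divide_right_mono sum_mono) auto

lemma avg_cong: "(\<And>i. i < N \<Longrightarrow> f i = g i) \<Longrightarrow> avg N f = avg N g"
  unfolding avg_def by simp

lemma avg_const: "N > 0 \<Longrightarrow> avg N (\<lambda>i. c) = c"
  unfolding avg_def by simp

lemma avg_add: "avg N (\<lambda>i. f i + g i) = avg N f + avg N g"
  unfolding avg_def by (simp add: sum.distrib add_divide_distrib)

lemma avg_diff: "avg N (\<lambda>i. f i - g i) = avg N f - avg N g"
  unfolding avg_def by (simp add: sum_subtractf diff_divide_distrib)

lemma avg_mult_left: "avg N (\<lambda>i. c * f i) = c * avg N f"
  unfolding avg_def by (simp add: sum_distrib_left)

lemma avg_mult_right: "avg N (\<lambda>i. f i * c) = avg N f * c"
  unfolding avg_def by (simp add: sum_distrib_right)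

lemma avg_divide: "avg N (\<lambda>i. f i / c) = avg N f / c"
  using avg_mult_right[of N f "inverse c"] by (simp add: divide_inverse)

lemma avg_swap: "avg N (\<lambda>i. avg M (\<lambda>j. f i j)) = avg M (\<lambda>j. avg N (\<lambda>i. f i j))"
  unfolding avg_def sum_divide_distrib[symmetric] by (subst sum.swap) (simp add: mult.commute)

lemma avg_le_const: "N > 0 \<Longrightarrow> (\<And>i. i < N \<Longrightarrow> f i \<le> c) \<Longrightarrow> avg N f \<le> c"
  using avg_mono[of N f "\<lambda>_. c"] avg_const[of N c] by simp

lemma finite_draws: "finite (draws N n)"
  unfolding draws_def by (intro finite_PiE) auto

lemma card_draws: "card (draws N n) = N ^ n"
  unfolding draws_def by (simp add: card_PiE)

lemma draws_upd: "s \<in> draws N n \<Longrightarrow> j < n \<Longrightarrow> i < N \<Longrightarrow> s(j := i) \<in> draws N n"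
  unfolding draws_def by (auto simp: PiE_iff extensional_def)

lemma draws_Suc_upd: "s \<in> draws N n \<Longrightarrow> i < N \<Longrightarrow> s(n := i) \<in> draws N (Suc n)"
  unfolding draws_def by (auto simp: PiE_iff extensional_def)

lemma draws_less: "s \<in> draws N n \<Longrightarrow> j < n \<Longrightarrow> s j < N"
  unfolding draws_def by auto

lemma draw_mean_mono: "(\<And>s. s \<in> draws N n \<Longrightarrow> f s \<le> g s) \<Longrightarrow> draw_mean N n f \<le> draw_mean N n g"
  unfolding draw_mean_def by (intro divide_right_mono sum_mono) auto

lemma draw_mean_diff: "draw_mean N n (\<lambda>s. f s - g s) = draw_mean N n f - draw_mean N n g"
  unfolding draw_mean_def by (simp add: sum_subtractf diff_divide_distrib)

lemma draw_mean_mult_left: "draw_mean N n (\<lambda>s. c * f s) = c * draw_mean N n f"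
  unfolding draw_mean_def by (simp add: sum_distrib_left)

lemma draw_mean_const: "N > 0 \<Longrightarrow> draw_mean N n (\<lambda>s. c) = c"
  unfolding draw_mean_def by (simp add: card_draws)

lemma draw_mean_0: "draw_mean N 0 f = f (\<lambda>_. undefined)"
  unfolding draw_mean_def draws_def by simp

text \<open>Fubini: conditioning on the last draw, at index \<open>n\<close>. The inductions for
  McDiarmid's inequality and for symmetrization peel off draws in this way.\<close>

lemma draw_mean_Suc: "draw_mean N (Suc n) f = avg N (\<lambda>i. draw_mean N n (\<lambda>s. f (s(n := i))))"
proof -
  have "draws N (Suc n) = (\<lambda>(i, s). s(n := i)) ` ({..<N} \<times> draws N n)"
    unfolding draws_def lessThan_Suc by (rule PiE_insert_eq)
  moreover have "inj_on (\<lambda>(i, s). s(n := i)) ({..<N} \<times> draws N n)"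
    unfolding draws_def by (rule inj_combinator) simp
  ultimately have "(\<Sum>s\<in>draws N (Suc n). f s) = (\<Sum>i<N. \<Sum>s\<in>draws N n. f (s(n := i)))"
    by (simp add: sum.reindex sum.cartesian_product case_prod_unfold)
  then show ?thesis
    unfolding draw_mean_def avg_def by (simp add: sum_divide_distrib[symmetric] mult.commute)
qed

subsection \<open>McDiarmid's inequality for uniform draws\<close>

text \<open>Hoeffding's lemma for a uniform index, phrased with pairwise differences because these
  are what bounded differences give for conditional means.\<close>

lemma hoeffding_avg:
  assumes N: "N > 0" and "r > 0"
    and range: "\<And>i k. i < N \<Longrightarrow> k < N \<Longrightarrow> X i - X k \<le> c"
  shows "avg N (\<lambda>i. exp (r * X i)) \<le> exp (r * avg N X) * exp (r\<^sup>2 * c\<^sup>2 / 8)"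
proof -
  define p where "p = pmf_of_set {..<N}"
  \<comment> \<open>The minimum is attained, so the difference bound places all values in
    \<open>{m..m + c}\<close>, the interval that Hoeffding's lemma asks for.\<close>
  define m where "m = Min (X ` {..<N})"
  have ne: "{..<N} \<noteq> {}" using N by (auto simp: lessThan_empty_iff)
  have "m \<in> X ` {..<N}" unfolding m_def using ne by (intro Min_in) auto
  then obtain k where k: "k < N" "m = X k" by auto
  have X: "X i \<in> {m..m + c}" if "i < N" for i
  proof -
    have "m \<le> X i" unfolding m_def using that by (intro Min_le) auto
    then show ?thesis using range[OF that k(1)] k(2) by simp
  qed
  have set: "set_pmf p = {..<N}" unfolding p_def using ne by simp
  interpret interval_bounded_random_variable "measure_pmf p" X m "m + c"
    by unfold_locales (use X in \<open>auto simp: AE_measure_pmf_iff set\<close>)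
  have E: "measure_pmf.expectation p h = avg N h" for h :: "nat \<Rightarrow> real"
    unfolding p_def avg_def using ne by (subst integral_pmf_of_set) auto
  have "nn_integral p (\<lambda>x. ennreal (exp (r * (X x - avg N X)))) \<le> ennreal (exp (r\<^sup>2 * c\<^sup>2 / 8))"
    using Hoeffdings_lemma_nn_integral[OF \<open>r > 0\<close>] by (simp add: E)
  moreover have "nn_integral p (\<lambda>x. ennreal (exp (r * (X x - avg N X)))) =
      ennreal (avg N (\<lambda>x. exp (r * (X x - avg N X))))"
    unfolding E[symmetric]
    by (rule nn_integral_eq_integral)
      (auto intro!: integrable_measure_pmf_finite simp: set)
  ultimately have "avg N (\<lambda>x. exp (r * (X x - avg N X))) \<le> exp (r\<^sup>2 * c\<^sup>2 / 8)"
    by simp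
  moreover have "avg N (\<lambda>x. exp (r * X x)) = exp (r * avg N X) * avg N (\<lambda>x. exp (r * (X x - avg N X)))"
    by (subst avg_mult_left[where c = "exp (r * avg N X)", symmetric], rule avg_cong)
      (simp add: exp_add[symmetric] algebra_simps)
  ultimately show ?thesis by simp
qed

text \<open>Induction replaces the martingale argument: for each fixed last draw the induction
  hypothesis treats the earlier ones. This leaves the exponential moment of the conditional means
  \<open>X i\<close>, which differ pairwise by at most \<open>c\<close>, so Hoeffding's lemma treats
  the last draw.\<close>

lemma mcdiarmid_mgf:
  assumes N: "N > 0" and r: "r > 0"
    and "\<And>s j i. s \<in> draws N n \<Longrightarrow> j < n \<Longrightarrow> i < N \<Longrightarrow> F s - F (s(j := i)) \<le> c"
  shows "draw_mean N n (\<lambda>s. exp (r * F s)) \<le> exp (r * draw_mean N n F) * exp (real n * (r\<^sup>2 * c\<^sup>2 / 8))"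
  using assms(3)
proof (induction n arbitrary: F)
  case 0
  then show ?case by (simp add: draw_mean_0)
next
  case (Suc n)
  define X where "X = (\<lambda>i. draw_mean N n (\<lambda>s. F (s(n := i))))"
  have "draw_mean N (Suc n) (\<lambda>s. exp (r * F s)) = avg N (\<lambda>i. draw_mean N n (\<lambda>s. exp (r * F (s(n := i)))))"
    by (rule draw_mean_Suc)
  also have "\<dots> \<le> avg N (\<lambda>i. exp (r * X i) * exp (real n * (r\<^sup>2 * c\<^sup>2 / 8)))"
    unfolding X_def
  proof (intro avg_mono Suc.IH)
    fix i s j k assume *: "i < N" "s \<in> draws N n" "j < n" "k < N"
    have "F (s(n := i)) - F (s(n := i, j := k)) \<le> c"
      using * by (intro Suc.prems draws_Suc_upd) auto
    moreover have "s(n := i, j := k) = s(j := k, n := i)"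
      using * by (intro fun_upd_twist) auto
    ultimately show "F (s(n := i)) - F (s(j := k, n := i)) \<le> c" by simp
  qed
  also have "\<dots> = avg N (\<lambda>i. exp (r * X i)) * exp (real n * (r\<^sup>2 * c\<^sup>2 / 8))"
    by (rule avg_mult_right)
  also have "\<dots> \<le> exp (r * avg N X) * exp (r\<^sup>2 * c\<^sup>2 / 8) * exp (real n * (r\<^sup>2 * c\<^sup>2 / 8))"
  proof (intro mult_right_mono hoeffding_avg N r)
    fix i k assume *: "i < N" "k < N"
    have "X i - X k \<le> draw_mean N n (\<lambda>s. c)"
      unfolding X_def draw_mean_diff[symmetric]
    proof (rule draw_mean_mono)
      fix s assume "s \<in> draws N n"
      \<comment> \<open>The second update overwrites the first, so bounded differences in coordinate
        \<open>n\<close> compare \<open>X i\<close> and \<open>X k\<close> sample by sample.\<close>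
      then have "F (s(n := i)) - F (s(n := i, n := k)) \<le> c"
        using * by (intro Suc.prems draws_Suc_upd) auto
      then show "F (s(n := i)) - F (s(n := k)) \<le> c"
        by (simp only: fun_upd_upd)
    qed
    then show "X i - X k \<le> c" using N by (simp add: draw_mean_const)
  qed auto
  also have "\<dots> = exp (r * draw_mean N (Suc n) F) * exp (real (Suc n) * (r\<^sup>2 * c\<^sup>2 / 8))"
    unfolding draw_mean_Suc X_def by (simp add: exp_add[symmetric] algebra_simps)
  finally show ?case .
qed

lemma mcdiarmid_tail:
  assumes N: "N > 0" and n: "n > 0" and c: "c > 0" and t: "t > 0"
    and bd: "\<And>s j i. s \<in> draws N n \<Longrightarrow> j < n \<Longrightarrow> i < N \<Longrightarrow> F s - F (s(j := i)) \<le> c"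
  shows "draw_mean N n (\<lambda>s. of_bool (F s > draw_mean N n F + t)) \<le> exp (- 2 * t\<^sup>2 / (real n * c\<^sup>2))"
proof -
  \<comment> \<open>The Chernoff parameter: this \<open>r\<close> minimises the exponent
    \<open>real n * (r\<^sup>2 * c\<^sup>2 / 8) - r * t\<close>.\<close>
  define r where "r = 4 * t / (real n * c\<^sup>2)"
  have r: "r > 0" unfolding r_def using n c t by simp
  define m where "m = draw_mean N n F"
  have "draw_mean N n (\<lambda>s. of_bool (F s > m + t)) \<le> draw_mean N n (\<lambda>s. exp (- r * (m + t)) * exp (r * F s))"
    using r by (intro draw_mean_mono) (auto simp: exp_add[symmetric] of_bool_def)
  also have "\<dots> = exp (- r * (m + t)) * draw_mean N n (\<lambda>s. exp (r * F s))"
    by (rule draw_mean_mult_left)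
  also have "\<dots> \<le> exp (- r * (m + t)) * (exp (r * m) * exp (real n * (r\<^sup>2 * c\<^sup>2 / 8)))"
    unfolding m_def by (intro mult_left_mono mcdiarmid_mgf N r bd) auto
  also have "\<dots> = exp (real n * (r\<^sup>2 * c\<^sup>2 / 8) - r * t)"
    by (simp add: exp_add[symmetric] algebra_simps)
  also have "real n * (r\<^sup>2 * c\<^sup>2 / 8) - r * t = - 2 * t\<^sup>2 / (real n * c\<^sup>2)"
    unfolding r_def using n c by (simp add: field_simps power2_eq_square)
  finally show ?thesis unfolding m_def .
qed

subsection \<open>Symmetrization and contraction\<close>

text \<open>A real supremum bounds its members only for families bounded above. Two-sided
  boundedness is carried instead, because it survives both addition and subtraction of
  families.\<close>

lemma SUP_upper_bounded: "bounded (U ` T) \<Longrightarrow> t \<in> T \<Longrightarrow> U t \<le> (SUP t\<in>T. U t)" for U :: "'t \<Rightarrow> real"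
  by (intro cSUP_upper bounded_imp_bdd_above)

lemma bounded_avg_comp:
  assumes "\<And>i. i < N \<Longrightarrow> bounded (g i ` T)"
  shows "bounded ((\<lambda>t. avg N (\<lambda>i. g i t)) ` T)"
proof -
  have "bounded ((\<lambda>t. \<Sum>i<k. g i t) ` T)" if "k \<le> N" for k
    using that by (induction k) (auto intro!: bounded_plus_comp assms intro: boundedI)
  then have "bounded ((\<lambda>x. inverse (real N) *\<^sub>R x) ` (\<lambda>t. \<Sum>i<N. g i t) ` T)"
    by (intro bounded_scaling) simp
  then show ?thesis unfolding avg_def image_image by (simp add: divide_inverse mult.commute)
qed

text \<open>
  The expectation of \<open>SUP t. U t + (\<Sum>j<n. \<epsilon> j * p (s j) t + \<epsilon>' j * q (s j) t)\<close> over uniform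
  draws \<open>s\<close> and independent uniform signs \<open>\<epsilon>\<close>, \<open>\<epsilon>'\<close>; the recursion averages over one draw and its two
  signs, so that no product space of signs is needed.
\<close>

primrec signed_sup ::
    "'t set \<Rightarrow> nat \<Rightarrow> (nat \<Rightarrow> 't \<Rightarrow> real) \<Rightarrow> (nat \<Rightarrow> 't \<Rightarrow> real) \<Rightarrow> nat \<Rightarrow> ('t \<Rightarrow> real) \<Rightarrow> real" where
  "signed_sup T N p q 0 U = (SUP t\<in>T. U t)"
| "signed_sup T N p q (Suc n) U = avg N (\<lambda>i.
    (signed_sup T N p q n (\<lambda>t. U t + (p i t + q i t)) + signed_sup T N p q n (\<lambda>t. U t - (p i t + q i t)) +
     signed_sup T N p q n (\<lambda>t. U t + (p i t - q i t)) + signed_sup T N p q n (\<lambda>t. U t - (p i t - q i t))) / 4)"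

text \<open>
  The sign of \<open>g\<close> is traded for two independent signs of \<open>p\<close> and \<open>q\<close> because
  \<open>max \<bar>c\<bar> \<bar>d\<bar> = (\<bar>c + d\<bar> + \<bar>c - d\<bar>) / 2\<close> is the mean of \<open>\<bar>\<epsilon> * c + \<epsilon>' * d\<bar>\<close>.
\<close>

lemma symmetrized_contraction_sup:
  fixes T :: "'t set" and g p q :: "nat \<Rightarrow> 't \<Rightarrow> real"
  assumes N: "N > 0" and T: "T \<noteq> {}"
    and bg: "\<And>i. i < N \<Longrightarrow> bounded (g i ` T)"
    and bp: "\<And>i. i < N \<Longrightarrow> bounded (p i ` T)"
    and bq: "\<And>i. i < N \<Longrightarrow> bounded (q i ` T)"
    and lip: "\<And>i t t'. i < N \<Longrightarrow> t \<in> T \<Longrightarrow> t' \<in> T \<Longrightarrow>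
      2 * (g i t - g i t') \<le> max \<bar>p i t - p i t'\<bar> \<bar>q i t - q i t'\<bar>"
    and U: "bounded (U ` T)"
  shows "avg N (\<lambda>i. SUP t\<in>T. U t + (g i t - avg N (\<lambda>k. g k t))) \<le> signed_sup T N p q (Suc 0) U"
proof -
  define G where "G = (\<lambda>V :: 't \<Rightarrow> real. SUP t\<in>T. V t)"
  have up: "V t \<le> G V" if "bounded (V ` T)" "t \<in> T" for V t
    unfolding G_def using that by (rule SUP_upper_bounded)
  have least: "G V \<le> c" if "\<And>t. t \<in> T \<Longrightarrow> V t \<le> c" for V c
    unfolding G_def using T that by (rule cSUP_least)
  have b2: "bounded ((\<lambda>t. 2 * g i t) ` T)" if "i < N" for i
    unfolding mult_2 by (rule bounded_plus_comp[OF bg[OF that] bg[OF that]])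
  \<comment> \<open>The supremum of an average is at most the average of the suprema. Doubling and
    halving splits the term so that the draw \<open>i\<close> and its independent copy
    \<open>k\<close> land in separate suprema.\<close>
  have jensen: "G (\<lambda>t. U t + (g i t - avg N (\<lambda>k. g k t))) \<le>
      avg N (\<lambda>k. (G (\<lambda>t. U t + 2 * g i t) + G (\<lambda>t. U t - 2 * g k t)) / 2)" if i: "i < N" for i
  proof (rule least)
    fix t assume t: "t \<in> T"
    have "U t + (g i t - avg N (\<lambda>k. g k t)) = avg N (\<lambda>k. ((U t + 2 * g i t) + (U t - 2 * g k t)) / 2)"
      by (simp only: avg_divide avg_add avg_diff avg_const[OF N] avg_mult_left) simp
    also have "\<dots> \<le> avg N (\<lambda>k. (G (\<lambda>t. U t + 2 * g i t) + G (\<lambda>t. U t - 2 * g k t)) / 2)"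
    proof (intro avg_mono divide_right_mono add_mono)
      show "U t + 2 * g i t \<le> G (\<lambda>t. U t + 2 * g i t)"
        by (rule up[OF bounded_plus_comp[OF U b2[OF i]] t])
      show "U t - 2 * g k t \<le> G (\<lambda>t. U t - 2 * g k t)" if "k < N" for k
        by (rule up[OF bounded_minus_comp[OF U b2[OF that]] t])
    qed simp
    finally show "U t + (g i t - avg N (\<lambda>k. g k t)) \<le> \<dots>" .
  qed
  have "avg N (\<lambda>i. G (\<lambda>t. U t + (g i t - avg N (\<lambda>k. g k t)))) \<le>
      avg N (\<lambda>i. avg N (\<lambda>k. (G (\<lambda>t. U t + 2 * g i t) + G (\<lambda>t. U t - 2 * g k t)) / 2))"
    by (intro avg_mono jensen)
  \<comment> \<open>As \<open>i\<close> and \<open>k\<close> no longer share a supremum,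
    \<open>k\<close> may be renamed to \<open>i\<close>; what remains is the mean over one random
    sign of \<open>2 * g i\<close>.\<close>
  also have "\<dots> = avg N (\<lambda>i. (G (\<lambda>t. U t + 2 * g i t) + G (\<lambda>t. U t - 2 * g i t)) / 2)"
    by (simp only: avg_divide avg_add avg_const[OF N])
  also have "\<dots> \<le> avg N (\<lambda>i. (G (\<lambda>t. U t + (p i t + q i t)) + G (\<lambda>t. U t - (p i t + q i t)) +
     G (\<lambda>t. U t + (p i t - q i t)) + G (\<lambda>t. U t - (p i t - q i t))) / 4)"
  proof (rule avg_mono)
    fix i assume i: "i < N"
    define S where "S = (G (\<lambda>t. U t + (p i t + q i t)) + G (\<lambda>t. U t - (p i t + q i t)) +
     G (\<lambda>t. U t + (p i t - q i t)) + G (\<lambda>t. U t - (p i t - q i t))) / 2"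
    \<comment> \<open>A sum of two suprema is controlled through arbitrary pairs of points; the
      suprema over \<open>t'\<close> and \<open>t\<close> are taken one after the other
      afterwards.\<close>
    have pair: "(U t + 2 * g i t) + (U t' - 2 * g i t') \<le> S" if t: "t \<in> T" "t' \<in> T" for t t'
    proof -
      have b: "bounded ((\<lambda>t. U t + (p i t + q i t)) ` T)" "bounded ((\<lambda>t. U t - (p i t + q i t)) ` T)"
        "bounded ((\<lambda>t. U t + (p i t - q i t)) ` T)" "bounded ((\<lambda>t. U t - (p i t - q i t)) ` T)"
        by (intro bounded_plus_comp bounded_minus_comp U bp[OF i] bq[OF i])+
      note u = up[OF b(1)] up[OF b(2)] up[OF b(3)] up[OF b(4)]
      define c where "c = p i t - p i t'"
      define d where "d = q i t - q i t'"
      define x where "x = \<bar>c + d\<bar>"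
      define y where "y = \<bar>c - d\<bar>"
      have "max \<bar>c\<bar> \<bar>d\<bar> \<le> (x + y) / 2"
        unfolding x_def y_def by (simp add: abs_if)
      then have "2 * (g i t - g i t') \<le> (x + y) / 2"
        using lip[OF i t] unfolding c_def d_def by (rule order_trans[rotated])
      \<comment> \<open>The absolute value is resolved by evaluating the two suprema at
        \<open>t\<close> and \<open>t'\<close> in one order or the other, according to the sign of
        \<open>c + d\<close>.\<close>
      moreover have "U t + U t' + x \<le> G (\<lambda>t. U t + (p i t + q i t)) + G (\<lambda>t. U t - (p i t + q i t))"
        using u(1,2)[OF t(1)] u(1,2)[OF t(2)] unfolding x_def c_def d_def by linarith
      moreover have "U t + U t' + y \<le> G (\<lambda>t. U t + (p i t - q i t)) + G (\<lambda>t. U t - (p i t - q i t))"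
        using u(3,4)[OF t(1)] u(3,4)[OF t(2)] unfolding y_def c_def d_def by linarith
      ultimately show ?thesis unfolding S_def by (simp add: field_simps)
    qed
    have "G (\<lambda>t. U t + 2 * g i t) \<le> S - G (\<lambda>t. U t - 2 * g i t)"
    proof (rule least)
      fix t assume t: "t \<in> T"
      have "G (\<lambda>t. U t - 2 * g i t) \<le> S - (U t + 2 * g i t)"
        by (rule least) (use pair[OF t] in \<open>simp add: le_diff_eq add.commute\<close>)
      then show "U t + 2 * g i t \<le> S - G (\<lambda>t. U t - 2 * g i t)" by simp
    qed
    then show "(G (\<lambda>t. U t + 2 * g i t) + G (\<lambda>t. U t - 2 * g i t)) / 2 \<le>
      (G (\<lambda>t. U t + (p i t + q i t)) + G (\<lambda>t. U t - (p i t + q i t)) +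
       G (\<lambda>t. U t + (p i t - q i t)) + G (\<lambda>t. U t - (p i t - q i t))) / 4"
      unfolding S_def add_divide_distrib by simp
  qed
  finally show ?thesis unfolding G_def by simp
qed

text \<open>Exchanges one centred draw for a signed one in the presence of \<open>n\<close> signed
  draws. The average over the centred draw commutes with that over the outermost signed draw, whose
  terms are absorbed into the offset \<open>U\<close>, so induction leads down to a bare
  supremum.\<close>

lemma symmetrized_contraction_step:
  fixes T :: "'t set" and g p q :: "nat \<Rightarrow> 't \<Rightarrow> real"
  assumes N: "N > 0" and T: "T \<noteq> {}"
    and bg: "\<And>i. i < N \<Longrightarrow> bounded (g i ` T)"
    and bp: "\<And>i. i < N \<Longrightarrow> bounded (p i ` T)"
    and bq: "\<And>i. i < N \<Longrightarrow> bounded (q i ` T)"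
    and lip: "\<And>i t t'. i < N \<Longrightarrow> t \<in> T \<Longrightarrow> t' \<in> T \<Longrightarrow>
      2 * (g i t - g i t') \<le> max \<bar>p i t - p i t'\<bar> \<bar>q i t - q i t'\<bar>"
    and U: "bounded (U ` T)"
  shows "avg N (\<lambda>i. signed_sup T N p q n (\<lambda>t. U t + (g i t - avg N (\<lambda>k. g k t)))) \<le>
    signed_sup T N p q (Suc n) U"
  using U
proof (induction n arbitrary: U)
  case 0
  then show ?case
    using symmetrized_contraction_sup[OF N T bg bp bq lip 0] by simp
next
  case (Suc n)
  define w where "w = (\<lambda>i t. g i t - avg N (\<lambda>k. g k t))"
  define H where "H = signed_sup T N p q n"
  define K where "K = (\<lambda>V. avg N (\<lambda>i. H (\<lambda>t. V t + w i t)))"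
  have IH: "K V \<le> signed_sup T N p q (Suc n) V" if "bounded (V ` T)" for V
    unfolding K_def H_def w_def by (rule Suc.IH[OF that])
  have swap: "(\<lambda>t. U t + w i t + f t) = (\<lambda>t. U t + f t + w i t)"
    "(\<lambda>t. U t + w i t - f t) = (\<lambda>t. U t - f t + w i t)" for i f
    by auto
  have "avg N (\<lambda>i. signed_sup T N p q (Suc n) (\<lambda>t. U t + w i t)) =
    avg N (\<lambda>j. avg N (\<lambda>i.
      (H (\<lambda>t. U t + w i t + (p j t + q j t)) + H (\<lambda>t. U t + w i t - (p j t + q j t)) +
       H (\<lambda>t. U t + w i t + (p j t - q j t)) + H (\<lambda>t. U t + w i t - (p j t - q j t))) / 4))"
    unfolding H_def by (simp only: signed_sup.simps) (rule avg_swap)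
  also have "\<dots> = avg N (\<lambda>j.
      (K (\<lambda>t. U t + (p j t + q j t)) + K (\<lambda>t. U t - (p j t + q j t)) +
       K (\<lambda>t. U t + (p j t - q j t)) + K (\<lambda>t. U t - (p j t - q j t))) / 4)"
    unfolding K_def by (simp only: avg_divide avg_add swap)
  also have "\<dots> \<le> signed_sup T N p q (Suc (Suc n)) U"
    unfolding signed_sup.simps(2)[of T N p q "Suc n"]
    by (intro avg_mono divide_right_mono add_mono IH bounded_plus_comp bounded_minus_comp Suc.prems bp bq) auto
  finally show ?case unfolding w_def .
qed

text \<open>The draws are exchanged one at a time: the last centred term joins the offset
  \<open>U\<close>, the induction hypothesis converts the others, and the previous lemma converts
  the last.\<close>

lemma draw_mean_sup_le_signed_sup:
  fixes T :: "'t set" and g p q :: "nat \<Rightarrow> 't \<Rightarrow> real"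
  assumes N: "N > 0" and T: "T \<noteq> {}"
    and bg: "\<And>i. i < N \<Longrightarrow> bounded (g i ` T)"
    and bp: "\<And>i. i < N \<Longrightarrow> bounded (p i ` T)"
    and bq: "\<And>i. i < N \<Longrightarrow> bounded (q i ` T)"
    and lip: "\<And>i t t'. i < N \<Longrightarrow> t \<in> T \<Longrightarrow> t' \<in> T \<Longrightarrow>
      2 * (g i t - g i t') \<le> max \<bar>p i t - p i t'\<bar> \<bar>q i t - q i t'\<bar>"
    and U: "bounded (U ` T)"
  shows "draw_mean N n (\<lambda>s. SUP t\<in>T. U t + (\<Sum>j<n. g (s j) t - avg N (\<lambda>k. g k t))) \<le>
    signed_sup T N p q n U"
  using U
proof (induction n arbitrary: U)
  case 0
  then show ?case by (simp add: draw_mean_0)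
next
  case (Suc n)
  define w where "w = (\<lambda>i t. g i t - avg N (\<lambda>k. g k t))"
  have "draw_mean N (Suc n) (\<lambda>s. SUP t\<in>T. U t + (\<Sum>j<Suc n. w (s j) t)) =
      avg N (\<lambda>i. draw_mean N n (\<lambda>s. SUP t\<in>T. U t + w i t + (\<Sum>j<n. w (s j) t)))"
    unfolding draw_mean_Suc by (simp add: add_ac)
  also have "\<dots> \<le> avg N (\<lambda>i. signed_sup T N p q n (\<lambda>t. U t + w i t))"
    unfolding w_def
    by (intro avg_mono Suc.IH bounded_plus_comp bounded_minus_comp bounded_avg_comp bg Suc.prems)
  also have "\<dots> \<le> signed_sup T N p q (Suc n) U"
    unfolding w_def by (rule symmetrized_contraction_step[OF N T bg bp bq lip Suc.prems])
  finally show ?case unfolding w_def .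
qed

section \<open>Signed suprema of linear processes\<close>

lemma sqrt_parallelogram:
  fixes u v :: "'a::real_inner"
  assumes "S \<ge> 0"
  shows "sqrt ((norm (u + v))\<^sup>2 + S) + sqrt ((norm (u - v))\<^sup>2 + S) \<le> 2 * sqrt ((norm u)\<^sup>2 + ((norm v)\<^sup>2 + S))"
proof -
  define x where "x = sqrt ((norm (u + v))\<^sup>2 + S)"
  define y where "y = sqrt ((norm (u - v))\<^sup>2 + S)"
  \<comment> \<open>The parallelogram law; the inequality after it is the concavity of
    \<open>sqrt\<close> in squared form. Together they average over one random sign.\<close>
  have "x\<^sup>2 + y\<^sup>2 = 2 * ((norm u)\<^sup>2 + ((norm v)\<^sup>2 + S))"
    unfolding x_def y_def using assms
    by (simp add: real_sqrt_pow2[OF add_nonneg_nonneg[OF zero_le_power2]] del: real_sqrt_pow2_iff) (simp add: power2_norm_eq_inner inner_add_left inner_add_right inner_diff_left inner_diff_right)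
  moreover have "(x + y)\<^sup>2 \<le> 2 * (x\<^sup>2 + y\<^sup>2)"
    using zero_le_power2[of "x - y"] by (simp add: power2_sum power2_diff)
  ultimately have "(x + y)\<^sup>2 \<le> 4 * ((norm u)\<^sup>2 + ((norm v)\<^sup>2 + S))" by simp
  then have "x + y \<le> sqrt (4 * ((norm u)\<^sup>2 + ((norm v)\<^sup>2 + S)))" by (rule real_le_rsqrt)
  then show ?thesis unfolding x_def y_def by (simp only: real_sqrt_mult real_sqrt_four)
qed

text \<open>Linear processes keep the offset linear, so \<open>a\<close> and \<open>b\<close>
  accumulate the signed sums. Cauchy-Schwarz bounds the final supremum by their norms, and each draw
  adds at most \<open>V\<^sup>2\<close> and \<open>W\<^sup>2\<close> under the roots.\<close>

lemma signed_sup_linear_le: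
  fixes v :: "nat \<Rightarrow> 'a::real_inner" and w :: "nat \<Rightarrow> 'b::real_inner"
  assumes N: "N > 0" and T: "T \<noteq> {}"
    and X: "X \<ge> 0" "\<And>t. t \<in> T \<Longrightarrow> norm (x t) \<le> X"
    and Y: "Y \<ge> 0" "\<And>t. t \<in> T \<Longrightarrow> norm (y t) \<le> Y"
    and v: "\<And>i. i < N \<Longrightarrow> norm (v i) \<le> V"
    and w: "\<And>i. i < N \<Longrightarrow> norm (w i) \<le> W"
  shows "signed_sup T N (\<lambda>i t. v i \<bullet> x t) (\<lambda>i t. w i \<bullet> y t) n (\<lambda>t. a \<bullet> x t + b \<bullet> y t) \<le>
    X * sqrt ((norm a)\<^sup>2 + real n * V\<^sup>2) + Y * sqrt ((norm b)\<^sup>2 + real n * W\<^sup>2)"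
proof (induction n arbitrary: a b)
  case 0
  have "a \<bullet> x t + b \<bullet> y t \<le> X * norm a + Y * norm b" if "t \<in> T" for t
  proof -
    have "a \<bullet> x t \<le> norm a * X" "b \<bullet> y t \<le> norm b * Y"
      using X(2)[OF that] Y(2)[OF that]
      by (auto intro!: order_trans[OF norm_cauchy_schwarz] mult_left_mono)
    then show ?thesis by (simp add: mult.commute)
  qed
  then show ?case using T by (simp add: cSUP_least)
next
  case (Suc n)
  define P where "P = (\<lambda>a. sqrt ((norm (a :: 'a))\<^sup>2 + real n * V\<^sup>2))"
  define Q where "Q = (\<lambda>b. sqrt ((norm (b :: 'b))\<^sup>2 + real n * W\<^sup>2))"
  define H where "H = (\<lambda>a b. signed_sup T N (\<lambda>i t. v i \<bullet> x t) (\<lambda>i t. w i \<bullet> y t) n (\<lambda>t. a \<bullet> x t + b \<bullet> y t))"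
  have IH: "H a b \<le> X * P a + Y * Q b" for a b
    unfolding H_def P_def Q_def by (rule Suc.IH)
  have "signed_sup T N (\<lambda>i t. v i \<bullet> x t) (\<lambda>i t. w i \<bullet> y t) (Suc n) (\<lambda>t. a \<bullet> x t + b \<bullet> y t) =
     avg N (\<lambda>i. (H (a + v i) (b + w i) + H (a - v i) (b - w i) + H (a + v i) (b - w i) + H (a - v i) (b + w i)) / 4)"
    unfolding H_def signed_sup.simps(2) by (simp add: inner_add_left inner_diff_left algebra_simps)
  also have "\<dots> \<le> X * sqrt ((norm a)\<^sup>2 + real (Suc n) * V\<^sup>2) + Y * sqrt ((norm b)\<^sup>2 + real (Suc n) * W\<^sup>2)"
  proof (rule avg_le_const[OF N])
    fix i assume i: "i < N"
    have "P (a + v i) + P (a - v i) \<le> 2 * sqrt ((norm a)\<^sup>2 + ((norm (v i))\<^sup>2 + real n * V\<^sup>2))"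
      unfolding P_def by (rule sqrt_parallelogram) simp
    also have "\<dots> \<le> 2 * sqrt ((norm a)\<^sup>2 + real (Suc n) * V\<^sup>2)"
      using power_mono[OF v[OF i], of 2] by (simp add: algebra_simps)
    finally have 1: "X * (P (a + v i) + P (a - v i)) \<le> X * (2 * sqrt ((norm a)\<^sup>2 + real (Suc n) * V\<^sup>2))"
      using X(1) by (rule mult_left_mono)
    have "Q (b + w i) + Q (b - w i) \<le> 2 * sqrt ((norm b)\<^sup>2 + ((norm (w i))\<^sup>2 + real n * W\<^sup>2))"
      unfolding Q_def by (rule sqrt_parallelogram) simp
    also have "\<dots> \<le> 2 * sqrt ((norm b)\<^sup>2 + real (Suc n) * W\<^sup>2)"
      using power_mono[OF w[OF i], of 2] by (simp add: algebra_simps)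
    finally have 2: "Y * (Q (b + w i) + Q (b - w i)) \<le> Y * (2 * sqrt ((norm b)\<^sup>2 + real (Suc n) * W\<^sup>2))"
      using Y(1) by (rule mult_left_mono)
    define r where "r = X * sqrt ((norm a)\<^sup>2 + real (Suc n) * V\<^sup>2)"
    define s where "s = Y * sqrt ((norm b)\<^sup>2 + real (Suc n) * W\<^sup>2)"
    \<comment> \<open>Among the four sign patterns every value of \<open>P\<close> and
      \<open>Q\<close> occurs twice, so these two bounds suffice for the mean.\<close>
    have "X * P (a + v i) + X * P (a - v i) \<le> 2 * r" "Y * Q (b + w i) + Y * Q (b - w i) \<le> 2 * s"
      using 1 2 unfolding r_def s_def by (simp_all only: distrib_left mult.left_commute)
    then show "(H (a + v i) (b + w i) + H (a - v i) (b - w i) + H (a + v i) (b - w i) + H (a - v i) (b + w i)) / 4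
      \<le> X * sqrt ((norm a)\<^sup>2 + real (Suc n) * V\<^sup>2) + Y * sqrt ((norm b)\<^sup>2 + real (Suc n) * W\<^sup>2)"
      using IH[of "a + v i" "b + w i"] IH[of "a - v i" "b - w i"] IH[of "a + v i" "b - w i"]
        IH[of "a - v i" "b + w i"] unfolding r_def[symmetric] s_def[symmetric] add_divide_distrib by linarith
  qed
  finally show ?case .
qed

subsection \<open>Norms of matrices and transfer of probabilities\<close>

text \<open>The norm of the type is the Frobenius norm, the Euclidean norm of the row norms;
  Cauchy-Schwarz is applied to each row.\<close>

lemma op_norm_le_norm: "op_norm A \<le> norm A"
proof -
  have "norm (A *v x) \<le> norm A * norm x" for x
  proof -
    have "norm (A *v x) = L2_set (\<lambda>i. \<bar>A $ i \<bullet> x\<bar>) UNIV"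
      by (simp add: norm_vec_def matrix_vector_mul_component)
    also have "\<dots> \<le> L2_set (\<lambda>i. norm (A $ i) * norm x) UNIV"
      by (intro L2_set_mono Cauchy_Schwarz_ineq2) auto
    also have "\<dots> = norm A * norm x"
      unfolding norm_vec_def[of A] by (rule L2_set_left_distrib[symmetric]) simp
    finally show ?thesis .
  qed
  then show ?thesis unfolding op_norm_def by (rule onorm_le)
qed

lemma norm_outer: "norm (outer v) = (norm v)\<^sup>2"
proof -
  have "(norm (outer v))\<^sup>2 = ((norm v)\<^sup>2)\<^sup>2"
    unfolding power2_norm_eq_inner
    by (simp add: outer_def inner_vec_def power2_eq_square sum_product mult_ac)
  then show ?thesis by (rule power2_eq_imp_eq) auto
qed

text \<open>The witness is \<open>sgn A\<close>, the normalised \<open>A\<close>, which is 0 for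
  \<open>A = 0\<close> and hence always in the unit ball.\<close>

lemma norm_le_of_inner_ball:
  fixes A :: "'a::real_inner"
  assumes "\<And>V. norm V \<le> 1 \<Longrightarrow> A \<bullet> V \<le> c"
  shows "norm A \<le> c"
proof -
  have "A \<bullet> sgn A = norm A"
    by (cases "A = 0") (simp_all add: sgn_div_norm power2_norm_eq_inner[symmetric] power2_eq_square)
  moreover have "A \<bullet> sgn A \<le> c"
    by (rule assms) (simp add: norm_sgn)
  ultimately show ?thesis by simp
qed

text \<open>By independence each sample in \<open>draws N n\<close> has a cylinder event of
  probability \<open>1 / real N ^ n\<close>, and these cylinders are disjoint, so counting good
  samples bounds the probability from below.\<close>

lemma (in prob_space) prob_iid_draws:
  fixes I :: "nat \<Rightarrow> 'a \<Rightarrow> nat"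
  assumes N: "N > 0" and n: "n > 0"
    and indep: "indep_vars (\<lambda>_. count_space UNIV) I {..<n}"
    and distr: "\<And>j. j < n \<Longrightarrow> distr M (count_space UNIV) (I j) = measure_pmf (pmf_of_set {..<N})"
    and Q: "\<And>s s'. (\<And>j. j < n \<Longrightarrow> s j = s' j) \<Longrightarrow> Q s = Q s'"
  shows "draw_mean N n (\<lambda>s. of_bool (Q s)) \<le> prob {\<omega> \<in> space M. Q (\<lambda>j. I j \<omega>)}"
proof -
  define E where "E = (\<lambda>s. {\<omega> \<in> space M. \<forall>j<n. I j \<omega> = s j})"
  have rv: "random_variable (count_space UNIV) (I j)" if "j < n" for j
    using indep that unfolding indep_vars_def by auto
  have E_INT: "E s = (\<Inter>j\<in>{..<n}. I j -` {s j} \<inter> space M)" for s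
    unfolding E_def using n by auto
  have E_sets: "E s \<in> events" for s
    unfolding E_INT using n by (intro sets.finite_INT measurable_sets[OF rv]) auto
  have E_prob: "prob (E s) = 1 / real N ^ n" if s: "s \<in> draws N n" for s
  proof -
    have "prob (E s) = (\<Prod>j<n. prob (I j -` {s j} \<inter> space M))"
      unfolding E_INT using n by (intro indep_varsD_finite[OF indep]) auto
    also have "\<dots> = (\<Prod>j<n. 1 / real N)"
    proof (rule prod.cong)
      fix j assume "j \<in> {..<n}"
      then have j: "j < n" by simp
      have "prob (I j -` {s j} \<inter> space M) = measure (distr M (count_space UNIV) (I j)) {s j}"
        using rv[OF j] by (subst measure_distr) auto
      also have "\<dots> = pmf (pmf_of_set {..<N}) (s j)"
        unfolding distr[OF j] by (simp add: measure_pmf_single)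
      also have "\<dots> = 1 / real N"
        using draws_less[OF s j] N by (subst pmf_of_set) (auto simp: lessThan_empty_iff)
      finally show "prob (I j -` {s j} \<inter> space M) = 1 / real N" .
    qed simp
    finally show ?thesis by (simp add: power_one_over)
  qed
  have disj: "disjoint_family_on E (draws N n)"
    unfolding disjoint_family_on_def
  proof (intro ballI impI)
    fix s s' assume s: "s \<in> draws N n" "s' \<in> draws N n" "s \<noteq> s'"
    then obtain j where "j < n" "s j \<noteq> s' j"
      unfolding draws_def by (metis PiE_ext lessThan_iff)
    then show "E s \<inter> E s' = {}" unfolding E_def by auto
  qed
  \<comment> \<open>The indices may leave \<open>{..<N}\<close> on a null set, so the union runs
    over all natural values; it is countable, which gives measurability of the event.\<close>
  have Un: "{\<omega> \<in> space M. Q (\<lambda>j. I j \<omega>)} = (\<Union>s\<in>{s \<in> {..<n} \<rightarrow>\<^sub>E UNIV. Q s}. E s)"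
  proof (intro equalityI subsetI)
    fix \<omega> assume \<omega>: "\<omega> \<in> {\<omega> \<in> space M. Q (\<lambda>j. I j \<omega>)}"
    define s where "s = restrict (\<lambda>j. I j \<omega>) {..<n}"
    have "Q s = Q (\<lambda>j. I j \<omega>)" by (rule Q) (simp add: s_def)
    moreover have "\<omega> \<in> E s" unfolding E_def s_def using \<omega> by simp
    moreover have "s \<in> {..<n} \<rightarrow>\<^sub>E UNIV" unfolding s_def by simp
    ultimately show "\<omega> \<in> (\<Union>s\<in>{s \<in> {..<n} \<rightarrow>\<^sub>E UNIV. Q s}. E s)" using \<omega> by blast
  next
    fix \<omega> assume "\<omega> \<in> (\<Union>s\<in>{s \<in> {..<n} \<rightarrow>\<^sub>E UNIV. Q s}. E s)"
    then obtain s where s: "Q s" "\<omega> \<in> E s" by blast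
    then have "Q (\<lambda>j. I j \<omega>) = Q s" by (intro Q) (simp add: E_def)
    then show "\<omega> \<in> {\<omega> \<in> space M. Q (\<lambda>j. I j \<omega>)}" using s by (simp add: E_def)
  qed
  have cnt: "countable {s \<in> {..<n} \<rightarrow>\<^sub>E (UNIV :: nat set). Q s}"
    by (rule countable_subset[OF _ countable_PiE[of "{..<n}" "\<lambda>_. UNIV"]]) auto
  have meas: "{\<omega> \<in> space M. Q (\<lambda>j. I j \<omega>)} \<in> events"
    unfolding Un using E_sets by (intro sets.countable_UN'[OF cnt]) auto
  have sub: "(\<Union>s\<in>{s \<in> draws N n. Q s}. E s) \<subseteq> {\<omega> \<in> space M. Q (\<lambda>j. I j \<omega>)}"
  proof
    fix \<omega> assume "\<omega> \<in> (\<Union>s\<in>{s \<in> draws N n. Q s}. E s)"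
    then obtain s where s: "Q s" "\<omega> \<in> E s" by blast
    then have "Q (\<lambda>j. I j \<omega>) = Q s" by (intro Q) (simp add: E_def)
    then show "\<omega> \<in> {\<omega> \<in> space M. Q (\<lambda>j. I j \<omega>)}" using s by (simp add: E_def)
  qed
  have "draw_mean N n (\<lambda>s. of_bool (Q s)) = (\<Sum>s\<in>{s \<in> draws N n. Q s}. 1 / real N ^ n)"
    unfolding draw_mean_def using finite_draws by (simp add: Int_def)
  also have "\<dots> = (\<Sum>s\<in>{s \<in> draws N n. Q s}. prob (E s))"
    by (intro sum.cong) (auto simp: E_prob)
  also have "\<dots> = prob (\<Union>s\<in>{s \<in> draws N n. Q s}. E s)"
    using disj E_sets finite_draws
    by (intro finite_measure_finite_Union[symmetric]) (auto simp: disjoint_family_on_def)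
  also have "\<dots> \<le> prob {\<omega> \<in> space M. Q (\<lambda>j. I j \<omega>)}"
    by (rule finite_measure_mono[OF sub meas])
  finally show ?thesis .
qed

lemma sum_fun_upd_diff:
  fixes h :: "'a \<Rightarrow> real" and j n :: nat
  assumes "j < n"
  shows "(\<Sum>k<n. h (s k)) = (\<Sum>k<n. h ((s(j := i)) k)) + (h (s j) - h i)"
proof -
  have "(\<Sum>k<n. h (s k)) - (\<Sum>k<n. h ((s(j := i)) k)) = (\<Sum>k<n. if k = j then h (s j) - h i else 0)"
    unfolding sum_subtractf[symmetric] by (intro sum.cong) auto
  also have "\<dots> = h (s j) - h i" using assms by simp
  finally show ?thesis by simp
qed

subsection \<open>Uniform deviation of the Hessians\<close>

lemma draws_deviation_tail:
  fixes a :: "nat \<Rightarrow> real ^ 'd" and l2 :: "real \<Rightarrow> real"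
  assumes N: "N > 0" and n: "n > 0"
    and aR: "\<And>i. i < N \<Longrightarrow> norm (a i) \<le> R"
    and D: "D > 0"
    and lip: "M-lipschitz_on UNIV l2"
    and l2: "\<And>i x. i < N \<Longrightarrow> norm x \<le> D \<Longrightarrow> 0 \<le> l2 (a i \<bullet> x) \<and> l2 (a i \<bullet> x) \<le> B"
    and \<delta>: "0 < \<delta>" "\<delta> < 1"
    and \<mu>: "\<mu> = sqrt (4 * pi) * (R\<^sup>2 / sqrt (real n)) *
      (B * (2 + sqrt (1 / (2 * pi) * ln (1 / \<delta>))) + R * M * D)"
  defines "T \<equiv> cball 0 D \<times> cball 0 1"
  defines "g \<equiv> \<lambda>i (x, V). l2 (a i \<bullet> x) * (outer (a i) \<bullet> V)"
  defines "W \<equiv> \<lambda>s t. \<Sum>j<n. g (s j) t - avg N (\<lambda>k. g k t)"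
  shows "draw_mean N n (\<lambda>s. of_bool (\<exists>t\<in>T. W s t > real n * \<mu>)) \<le> \<delta>"
proof -
  have M: "M \<ge> 0" using lip by (rule lipschitz_on_nonneg)
  have R: "R \<ge> 0" using aR[OF N] norm_ge_zero order_trans by blast
  have B: "B \<ge> 0" using l2[OF N, of 0] D by simp
  define K where "K = B * R\<^sup>2"
  have K0: "K \<ge> 0" unfolding K_def using B by simp
  have T: "T \<noteq> {}" unfolding T_def using D by auto
  have outR: "norm (outer (a i)) \<le> R\<^sup>2" if "i < N" for i
    unfolding norm_outer using aR[OF that] by (intro power_mono) auto
  have tau: "\<bar>outer (a i) \<bullet> V\<bar> \<le> R\<^sup>2" if "i < N" "norm V \<le> 1" for i V
  proof -
    have "\<bar>outer (a i) \<bullet> V\<bar> \<le> norm (outer (a i)) * norm V" by (rule Cauchy_Schwarz_ineq2)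
    also have "\<dots> \<le> R\<^sup>2 * 1" using outR[OF that(1)] that(2) by (intro mult_mono) auto
    finally show ?thesis by simp
  qed
  have g: "\<bar>g i t\<bar> \<le> K" if "i < N" "t \<in> T" for i t
  proof -
    obtain x V where t: "t = (x, V)" "norm x \<le> D" "norm V \<le> 1"
      using \<open>t \<in> T\<close> unfolding T_def by (cases t) auto
    have "\<bar>l2 (a i \<bullet> x)\<bar> * \<bar>outer (a i) \<bullet> V\<bar> \<le> B * R\<^sup>2"
      using l2[OF that(1) t(2)] tau[OF that(1) t(3)] B by (intro mult_mono) auto
    then show ?thesis unfolding g_def K_def t(1) by (simp add: abs_mult)
  qed
  have g_diff: "g i t - g k t \<le> 2 * K" if "i < N" "k < N" "t \<in> T" for i k t
    using g[OF that(1,3)] g[OF that(2,3)] by linarith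
  \<comment> \<open>A crude bound: it makes the suprema over \<open>T\<close> meaningful and settles
    the case \<open>K = 0\<close>.\<close>
  have W_abs: "\<bar>W s t\<bar> \<le> real n * (2 * K)" if s: "s \<in> draws N n" and t: "t \<in> T" for s t
  proof -
    have "\<bar>g (s j) t - avg N (\<lambda>k. g k t)\<bar> \<le> 2 * K" if "j < n" for j
    proof -
      have "avg N (\<lambda>k. g k t) \<le> K" "avg N (\<lambda>k. - g k t) \<le> K"
        using abs_le_D1[OF g[OF _ t]] abs_le_D2[OF g[OF _ t]] by (intro avg_le_const[OF N]; blast)+
      moreover have "avg N (\<lambda>k. - g k t) = - avg N (\<lambda>k. g k t)"
        unfolding avg_def by (simp add: sum_negf)
      ultimately show ?thesis using g[OF draws_less[OF s that] t] by linarith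
    qed
    then have "(\<Sum>j<n. \<bar>g (s j) t - avg N (\<lambda>k. g k t)\<bar>) \<le> (\<Sum>j<n. 2 * K)"
      by (intro sum_mono) auto
    then have "\<bar>W s t\<bar> \<le> (\<Sum>j<n. 2 * K)"
      unfolding W_def by (rule order_trans[OF sum_abs])
    then show ?thesis by simp
  qed
  have L: "ln (1 / \<delta>) > 0" using \<delta> by simp
  define L where "L = ln (1 / \<delta>)"
  have L0: "L > 0" unfolding L_def by (rule L)
  have pi3: "3 \<le> sqrt (4 * pi)"
    by (rule real_le_rsqrt) (use pi_gt3 in simp)
  \<comment> \<open>Splits the threshold into a part for the mean and a part for the fluctuation; in
    the latter \<open>pi\<close> cancels and \<open>sqrt (2 * L)\<close> remains.\<close>
  have n\<mu>: "real n * \<mu> = sqrt (real n) * (sqrt (4 * pi) * (R ^ 3 * M * D + 2 * K) + K * sqrt (2 * L))"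
  proof -
    define c y S where "c = sqrt (4 * pi)" and "y = sqrt (1 / (2 * pi) * L)" and "S = sqrt (real n)"
    have cy: "c * y = sqrt (2 * L)"
      unfolding c_def y_def real_sqrt_mult[symmetric] by simp
    have S: "real n = S * S" "S > 0" unfolding S_def using n by simp_all
    have "real n * \<mu> = S * S * (c * (R\<^sup>2 / S) * (B * (2 + y) + R * M * D))"
      unfolding \<mu> c_def y_def S_def L_def by simp
    also have "\<dots> = S * (c * (R\<^sup>2 * (R * M * D) + 2 * (B * R\<^sup>2)) + B * R\<^sup>2 * (c * y))"
      using S(2) by (simp add: distrib_left mult_ac add_divide_distrib)
    also have "R\<^sup>2 * (R * M * D) = R ^ 3 * M * D"
      by (simp add: power2_eq_square power3_eq_cube mult_ac)
    finally show ?thesis unfolding cy unfolding K_def c_def S_def .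
  qed
  have R3: "R ^ 3 * M * D \<ge> 0" using R M D by simp
  show ?thesis
  proof (cases "K = 0")
    \<comment> \<open>McDiarmid's inequality asks for a positive difference bound; for
      \<open>K = 0\<close> all deviations are at most 0 and the failure event is empty.\<close>
    case True
    have "real n * \<mu> \<ge> 0" unfolding n\<mu> using R3 K0 L0 by simp
    moreover have "W s t \<le> 0" if "s \<in> draws N n" "t \<in> T" for s t
      using abs_le_D1[OF W_abs[OF that]] True by simp
    ultimately have "\<not> (\<exists>t\<in>T. W s t > real n * \<mu>)" if "s \<in> draws N n" for s
      using that by (meson not_less order_trans)
    then have "draw_mean N n (\<lambda>s. of_bool (\<exists>t\<in>T. W s t > real n * \<mu>)) \<le> draw_mean N n (\<lambda>s. 0)"
      by (intro draw_mean_mono) simp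
    then show ?thesis using N \<delta> by (simp add: draw_mean_const)
  next
    case False
    then have K: "K > 0" using K0 by simp
    define F where "F = (\<lambda>s. SUP t\<in>T. W s t)"
    have W_le: "W s t \<le> F s" if "s \<in> draws N n" "t \<in> T" for s t
      unfolding F_def using W_abs[OF that(1)] that(2)
      by (intro SUP_upper_bounded boundedI) auto
    txt \<open>
      Writing \<open>s\<close> for \<open>a i \<bullet> x\<close> and \<open>r\<close> for \<open>outer (a i) \<bullet> V\<close>, increments of \<open>g i\<close> are at most
      \<open>M * R\<^sup>2 * \<bar>\<Delta>s\<bar> + B * \<bar>\<Delta>r\<bar>\<close>. The weights 3 and 6 satisfy \<open>2/3 + 2/6 = 1\<close>, which turns twice this sum
      into a maximum, and both fit below the constants \<open>sqrt (4 * pi)\<close> and \<open>2 * sqrt (4 * pi)\<close> of \<open>\<mu>\<close>.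
    \<close>
    define v where "v = (\<lambda>i. (3 * M * R\<^sup>2) *\<^sub>R a i)"
    define w where "w = (\<lambda>i. (6 * B) *\<^sub>R outer (a i))"
    have v: "norm (v i) \<le> 3 * M * R ^ 3" if "i < N" for i
    proof -
      have "norm (v i) = (3 * M * R\<^sup>2) * norm (a i)" unfolding v_def using M by simp
      also have "\<dots> \<le> (3 * M * R\<^sup>2) * R" using aR[OF that] M by (intro mult_left_mono) auto
      finally show ?thesis by (simp add: power2_eq_square power3_eq_cube mult_ac)
    qed
    have w: "norm (w i) \<le> 6 * K" if "i < N" for i
      unfolding w_def K_def using outR[OF that] B by (simp add: mult_left_mono)
    have mean: "draw_mean N n F \<le> sqrt (real n) * (3 * (R ^ 3 * M * D) + 6 * K)"
    proof -
      have bdd: "bounded ((\<lambda>t. u i \<bullet> f t) ` T)" if "\<And>t. t \<in> T \<Longrightarrow> norm (f t) \<le> c"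
        for u :: "nat \<Rightarrow> 'x::real_inner" and f i c
      proof (intro boundedI)
        fix r assume "r \<in> (\<lambda>t. u i \<bullet> f t) ` T"
        then obtain t where t: "t \<in> T" "r = u i \<bullet> f t" by auto
        then have "norm r \<le> norm (u i) * norm (f t)" by (simp add: Cauchy_Schwarz_ineq2)
        also have "\<dots> \<le> norm (u i) * c" using that[OF t(1)] by (rule mult_left_mono) simp
        finally show "norm r \<le> norm (u i) * c" .
      qed
      have fst: "norm (fst t) \<le> D" and snd: "norm (snd t) \<le> 1" if "t \<in> T" for t
        using that unfolding T_def by auto
      have "draw_mean N n (\<lambda>s. SUP t\<in>T. 0 + W s t) \<le>
          signed_sup T N (\<lambda>i t. v i \<bullet> fst t) (\<lambda>i t. w i \<bullet> snd t) n (\<lambda>t. 0)"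
        unfolding W_def
      proof (rule draw_mean_sup_le_signed_sup[OF N T])
        show "bounded (g i ` T)" if "i < N" for i
          using g[OF that] by (intro boundedI) auto
        show "bounded ((\<lambda>t. v i \<bullet> fst t) ` T)" for i by (rule bdd) (rule fst)
        show "bounded ((\<lambda>t. w i \<bullet> snd t) ` T)" for i by (rule bdd) (rule snd)
        show "bounded ((\<lambda>t. 0::real) ` T)" by (intro boundedI) auto
        fix i t t' assume i: "i < N" and t: "t \<in> T" "t' \<in> T"
        obtain x V where tt: "t = (x, V)" "norm x \<le> D" "norm V \<le> 1"
          using t(1) unfolding T_def by (cases t) auto
        obtain x' V' where tt': "t' = (x', V')" "norm x' \<le> D" "norm V' \<le> 1"
          using t(2) unfolding T_def by (cases t') auto
        define s s' r r' where "s = a i \<bullet> x" and "s' = a i \<bullet> x'" and "r = outer (a i) \<bullet> V"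
          and "r' = outer (a i) \<bullet> V'"
        have "\<bar>l2 s - l2 s'\<bar> \<le> M * \<bar>s - s'\<bar>"
          using lipschitz_onD[OF lip, of s s'] by (simp add: dist_real_def)
        then have "\<bar>l2 s - l2 s'\<bar> * \<bar>r\<bar> \<le> M * \<bar>s - s'\<bar> * R\<^sup>2"
          using tau[OF i tt(3)] M unfolding r_def by (intro mult_mono) auto
        then have 1: "(l2 s - l2 s') * r \<le> M * \<bar>s - s'\<bar> * R\<^sup>2"
          by (simp add: abs_mult[symmetric])
        have "\<bar>l2 s'\<bar> * \<bar>r - r'\<bar> \<le> B * \<bar>r - r'\<bar>"
          using l2[OF i tt'(2)] unfolding s'_def by (intro mult_right_mono) auto
        then have 2: "l2 s' * (r - r') \<le> B * \<bar>r - r'\<bar>"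
          by (simp add: abs_mult[symmetric])
        have p: "\<bar>v i \<bullet> fst t - v i \<bullet> fst t'\<bar> = 3 * (M * \<bar>s - s'\<bar> * R\<^sup>2)"
        proof -
          have "v i \<bullet> fst t - v i \<bullet> fst t' = (3 * M * R\<^sup>2) * (s - s')"
            unfolding v_def tt(1) tt'(1) s_def s'_def by (simp add: right_diff_distrib)
          then show ?thesis using M by (simp add: abs_mult)
        qed
        have q: "\<bar>w i \<bullet> snd t - w i \<bullet> snd t'\<bar> = 6 * (B * \<bar>r - r'\<bar>)"
        proof -
          have "w i \<bullet> snd t - w i \<bullet> snd t' = (6 * B) * (r - r')"
            unfolding w_def tt(1) tt'(1) r_def r'_def by (simp add: right_diff_distrib)
          then show ?thesis using B by (simp add: abs_mult)
        qed
        have "g i t - g i t' = (l2 s - l2 s') * r + l2 s' * (r - r')"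
          unfolding g_def tt(1) tt'(1) s_def s'_def r_def r'_def by (simp add: algebra_simps)
        then have "2 * (g i t - g i t') \<le> 2 * (M * \<bar>s - s'\<bar> * R\<^sup>2) + 2 * (B * \<bar>r - r'\<bar>)"
          using 1 2 by simp
        moreover have "2 * x + 2 * y \<le> max (3 * x) (6 * y)" for x y :: real
          by (simp add: max_def)
        ultimately show "2 * (g i t - g i t') \<le>
            max \<bar>v i \<bullet> fst t - v i \<bullet> fst t'\<bar> \<bar>w i \<bullet> snd t - w i \<bullet> snd t'\<bar>"
          unfolding p q by (rule order_trans)
      qed
      \<comment> \<open>The zero offset is written as a linear one to start the accumulation at
        \<open>a = b = 0\<close>.\<close>
      also have "\<dots> = signed_sup T N (\<lambda>i t. v i \<bullet> fst t) (\<lambda>i t. w i \<bullet> snd t) n (\<lambda>t. 0 \<bullet> fst t + 0 \<bullet> snd t)"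
        by simp
      also have "\<dots> \<le> D * sqrt ((norm (0 :: real ^ 'd))\<^sup>2 + real n * (3 * M * R ^ 3)\<^sup>2) +
          1 * sqrt ((norm (0 :: real ^ 'd ^ 'd))\<^sup>2 + real n * (6 * K)\<^sup>2)"
        using D by (intro signed_sup_linear_le[OF N T] fst snd v w) auto
      also have "\<dots> = sqrt (real n) * (3 * (R ^ 3 * M * D) + 6 * K)"
      proof -
        have "sqrt (real n * (3 * M * R ^ 3)\<^sup>2) = sqrt (real n) * (3 * M * R ^ 3)"
          using M R by (simp only: real_sqrt_mult real_sqrt_abs) simp
        moreover have "sqrt (real n * (6 * K)\<^sup>2) = sqrt (real n) * (6 * K)"
          using K by (simp only: real_sqrt_mult real_sqrt_abs)
        ultimately show ?thesis by (simp add: distrib_left mult_ac)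
      qed
      finally show ?thesis unfolding F_def by simp
    qed
    \<comment> \<open>Chosen so that the McDiarmid exponent for differences \<open>2 * K\<close> is
      exactly \<open>- L\<close>.\<close>
    define \<tau> where "\<tau> = sqrt (real n) * (K * sqrt (2 * L))"
    have \<tau>0: "\<tau> > 0" unfolding \<tau>_def using n K L0 by simp
    have "3 * (R ^ 3 * M * D + 2 * K) \<le> sqrt (4 * pi) * (R ^ 3 * M * D + 2 * K)"
      using pi3 R3 K by (intro mult_right_mono) auto
    then have "sqrt (real n) * (3 * (R ^ 3 * M * D) + 6 * K + K * sqrt (2 * L)) \<le> real n * \<mu>"
      unfolding n\<mu> by (intro mult_left_mono) auto
    with mean have thr: "draw_mean N n F + \<tau> \<le> real n * \<mu>"
      unfolding \<tau>_def by (simp add: distrib_left)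
    have "draw_mean N n (\<lambda>s. of_bool (\<exists>t\<in>T. W s t > real n * \<mu>)) \<le>
        draw_mean N n (\<lambda>s. of_bool (F s > draw_mean N n F + \<tau>))"
    proof (rule draw_mean_mono)
      fix s assume s: "s \<in> draws N n"
      show "of_bool (\<exists>t\<in>T. W s t > real n * \<mu>) \<le> (of_bool (F s > draw_mean N n F + \<tau>) :: real)"
      proof (cases "\<exists>t\<in>T. W s t > real n * \<mu>")
        case True
        then obtain t where "t \<in> T" "W s t > real n * \<mu>" by blast
        then show ?thesis using W_le[OF s, of t] thr by simp
      qed simp
    qed
    also have "\<dots> \<le> exp (- 2 * \<tau>\<^sup>2 / (real n * (2 * K)\<^sup>2))"
    proof (rule mcdiarmid_tail[OF N n _ \<tau>0])
      fix s j i assume s: "s \<in> draws N n" and j: "j < n" and i: "i < N"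
      \<comment> \<open>Only the \<open>j\<close>-th summand changes, and its centring term cancels,
        so the bound holds at each \<open>t\<close> and passes to the supremum.\<close>
      have "F s \<le> F (s(j := i)) + 2 * K"
        unfolding F_def[THEN fun_cong, of s]
      proof (rule cSUP_least[OF T])
        fix t assume t: "t \<in> T"
        have "W s t = W (s(j := i)) t + (g (s j) t - g i t)"
          unfolding W_def using sum_fun_upd_diff[OF j, of "\<lambda>k. g k t - avg N (\<lambda>k. g k t)" s i] by simp
        also have "\<dots> \<le> F (s(j := i)) + 2 * K"
          by (intro add_mono W_le g_diff draws_upd s j i t draws_less[OF s j])
        finally show "W s t \<le> F (s(j := i)) + 2 * K" .
      qed
      then show "F s - F (s(j := i)) \<le> 2 * K" by simp
    qed (use K in simp)
    also have "- 2 * \<tau>\<^sup>2 / (real n * (2 * K)\<^sup>2) = - L"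
    proof -
      have "\<tau>\<^sup>2 = real n * (K\<^sup>2 * (2 * L))"
        unfolding \<tau>_def power_mult_distrib using L0 by simp
      then show ?thesis using n K by (simp add: power_mult_distrib)
    qed
    also have "exp (- L) = \<delta>" unfolding L_def using \<delta> by (simp add: ln_div)
    finally show ?thesis .
  qed
qed

section \<open>From draws to the Hessians\<close>

theorem theorem3:
  fixes a :: "nat \<Rightarrow> real ^ 'd"
    and l :: "nat \<Rightarrow> real \<Rightarrow> real"
    and l2 :: "real \<Rightarrow> real"
    and N n :: nat
    and lam R D B M \<delta> \<mu> :: real
    and P :: "'w measure"
    and I :: "nat \<Rightarrow> 'w \<Rightarrow> nat"
  assumes "N > 0" and "n > 0"
    and "\<And>i. i < N \<Longrightarrow> norm (a i) \<le> R"
    and "lam > 0" and "D > 0"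
    and "\<And>i t. i < N \<Longrightarrow> l i differentiable (at t)"
    and "\<And>i t. i < N \<Longrightarrow> (deriv (l i) has_real_derivative l2 t) (at t)"
    and "prob_space P"
    and "prob_space.indep_vars P (\<lambda>_. count_space UNIV) I {..<n}"
    and "\<And>j. j < n \<Longrightarrow> distr P (count_space UNIV) (I j) = measure_pmf (pmf_of_set {..<N})"
    and "M-lipschitz_on UNIV l2"
    and "AE v in measure_pmf (feature_pmf a N). \<forall>x\<in>cball 0 D. 0 \<le> l2 (v \<bullet> x) \<and> l2 (v \<bullet> x) \<le> B"
    and "0 < \<delta>" and "\<delta> < 1"
    and "\<mu> = sqrt (4 * pi) * (R\<^sup>2 / sqrt (real n)) *
      (B * (2 + sqrt (1 / (2 * pi) * ln (1 / \<delta>))) + R * M * D)"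
  shows "measure P {\<omega> \<in> space P.
      (SUP x\<in>cball 0 D. ereal (op_norm (hessian (local_loss lam a l n (\<lambda>j. I j \<omega>)) x
                                       - hessian (overall_loss lam a l N) x))) \<le> ereal \<mu>} \<ge> 1 - \<delta>"
proof -
  note N = assms(1) and n = assms(2) and diff = assms(6,7)
  define T :: "((real ^ 'd) \<times> (real ^ 'd ^ 'd)) set" where "T = cball 0 D \<times> cball 0 1"
  define g where "g = (\<lambda>i (x, V). l2 (a i \<bullet> x) * (outer (a i) \<bullet> V))"
  define W where "W = (\<lambda>s t. \<Sum>j<n. g (s j) t - avg N (\<lambda>k. g k t))"
  \<comment> \<open>The good event, stated pointwise in reals; in \<open>ereal\<close> it is
    equivalent to the bound on the supremum.\<close>
  define Q where "Q = (\<lambda>s. \<forall>x\<in>cball 0 D. op_norm (hessian (local_loss lam a l n s) x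
    - hessian (overall_loss lam a l N) x) \<le> \<mu>)"
  have set: "set_pmf (pmf_of_set {..<N}) = {..<N}"
    using N by (intro set_pmf_of_set) (auto simp: lessThan_empty_iff)
  \<comment> \<open>Every data point has positive mass, so the almost sure bound holds at each
    \<open>a i\<close>.\<close>
  have l2: "0 \<le> l2 (a i \<bullet> x) \<and> l2 (a i \<bullet> x) \<le> B" if "i < N" "norm x \<le> D" for i x
    using assms(12) that by (auto simp: AE_measure_pmf_iff feature_pmf_def set)
  have "draw_mean N n (\<lambda>s. of_bool (\<exists>t\<in>T. W s t > real n * \<mu>)) \<le> \<delta>"
    unfolding T_def W_def g_def
    by (rule draws_deviation_tail[OF N n assms(3) assms(5) assms(11) l2 assms(13-15)])
  then have "1 - \<delta> \<le> draw_mean N n (\<lambda>s. 1 - of_bool (\<exists>t\<in>T. W s t > real n * \<mu>))"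
    using N by (simp add: draw_mean_diff draw_mean_const)
  also have "\<dots> \<le> draw_mean N n (\<lambda>s. of_bool (Q s))"
  proof (rule draw_mean_mono)
    fix s assume s: "s \<in> draws N n"
    have "Q s" if W: "\<And>t. t \<in> T \<Longrightarrow> W s t \<le> real n * \<mu>"
      unfolding Q_def
    proof
      fix x :: "real ^ 'd" assume x: "x \<in> cball 0 D"
      define A where "A = (1 / real n) *\<^sub>R (\<Sum>j<n. l2 (a (s j) \<bullet> x) *\<^sub>R outer (a (s j))) -
        (1 / real N) *\<^sub>R (\<Sum>j<N. l2 (a j \<bullet> x) *\<^sub>R outer (a j))"
      \<comment> \<open>The regularisation terms of the two Hessians cancel.\<close>
      have A: "hessian (local_loss lam a l n s) x - hessian (overall_loss lam a l N) x = A"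
        unfolding A_def overall_loss_def
        using hessian_local_loss[of n s N l l2 lam a x] hessian_avg_loss[of N l "\<lambda>i. i" l2 lam a x]
          N n diff draws_less[OF s] by simp
      have "norm A \<le> \<mu>"
      proof (rule norm_le_of_inner_ball)
        fix V :: "real ^ 'd ^ 'd" assume "norm V \<le> 1"
        then have "(x, V) \<in> T" using x unfolding T_def by simp
        then have "W s (x, V) \<le> real n * \<mu>" by (rule W)
        moreover have "W s (x, V) = real n * (A \<bullet> V)"
          unfolding A_def W_def g_def avg_def using n
          by (simp add: inner_diff_left inner_sum_left sum_subtractf right_diff_distrib)
        ultimately show "A \<bullet> V \<le> \<mu>" using n by simp
      qed
      then show "op_norm (hessian (local_loss lam a l n s) x - hessian (overall_loss lam a l N) x) \<le> \<mu>"
        unfolding A using op_norm_le_norm order_trans by blast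
    qed
    then show "1 - of_bool (\<exists>t\<in>T. W s t > real n * \<mu>) \<le> (of_bool (Q s) :: real)"
      by (auto simp: not_less)
  qed
  also have "\<dots> \<le> measure P {\<omega> \<in> space P. Q (\<lambda>j. I j \<omega>)}"
  proof (rule prob_space.prob_iid_draws[OF assms(8) N n assms(9,10)])
    \<comment> \<open>The local loss reads only the first \<open>n\<close> indices, so the event is
      determined by the draws.\<close>
    fix s s' :: "nat \<Rightarrow> nat" assume "\<And>j. j < n \<Longrightarrow> s j = s' j"
    then have "local_loss lam a l n s = local_loss lam a l n s'"
      unfolding local_loss_def avg_loss_def by simp
    then show "Q s = Q s'" unfolding Q_def by simp
  qed
  finally show ?thesis unfolding Q_def SUP_le_iff by simp
qed

end
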